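(* Let $R$ be a QNA with Goodearl–Yakimov elements $y_1,\ldots,y_N$. For all subsets $I,J\subseteq[1,N]$, we have, inside the skew-field of fractions of $R$, $$RE_I^{-1}\cap RE_J^{-1}=RE_{I\cap J}^{-1}.$$
   Context: ${\mathbb K}$ is a field of characteristic $0$. A quantum nilpotent algebra (QNA) is an iterated Ore extension $R={\mathbb K}[x_1][x_2;\sigma_2,\delta_2]\cdots[x_N;\sigma_N,\delta_N]$, where $R_k={\mathbb K}[x_1][x_2;\sigma_2,\delta_2]\cdots[x_k;\sigma_k,\delta_k]$ ($R_0={\mathbb K}$), $\sigma_k$ is a ${\mathbb K}$-automorphism and $\delta_k$ a $\sigma_k$-derivation of $R_{k-1}$, together with a torus $\mathcal H$ acting rationally by ${\mathbb K}$-automorphisms on $R$ with each $x_i$ an $\mathcal H$-eigenvector, such that: (i) $\sigma_k(x_j)=\lambda_{kj}x_j$ for $j<k$, with $\lambda_{kj}\in{\mathbb K}^*$; (ii) $\delta_k$ is locally nilpotent on $R_{k-1}$; (iii) for each $k$ there exist $h_k\in\mathcal H$ and $q_k\in{\mathbb K}^*$ not a root of unity such that $h_k$ acts on $R_{k-1}$ as $\sigma_k$ and $h_k\cdot x_k=q_kx_k$. The rank is $n=|\{k:\delta_k=0\}|$ and $\mathcal H=({\mathbb K}^* )^n$ is taken maximal. Homogeneous elements are the $\mathcal H$-eigenvectors. An element $u$ is normal if $uR=Ru$; a prime element is a nonzero normal $p$ with $pR$ a completely prime ideal. Goodearl–Yakimov elements: there is a surjective map $\mu:[1,N]\to[1,n]$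 with predecessor $p(k)=\max\{j<k:\mu(j)=\mu(k)\}$ (or $-\infty$ if none) and successor $s(k)=\min\{j>k:\mu(j)=\mu(k)\}$ (or $+\infty$ if none), and homogeneous elements $y_1,\ldots,y_N\in R$, uniquely determined, with $y_k=x_k$ if $p(k)=-\infty$ and $y_k=y_{p(k)}x_k-c_k$ for some $c_k\in R_{k-1}$ otherwise, such that for every $k$ the set $\{y_j: j\le k,\ s(j)>k\}$ is, up to nonzero scalars, the set of homogeneous prime elements of $R_k$. The $y_i$ pairwise quasi-commute. For $I\subseteq[1,N]$, $E_I$ denotes the multiplicative subset of $R$ generated by $\{y_k:k\in I\}$ (together with $1$); it is an Ore set, and $RE_I^{-1}$ denotes the corresponding localization, viewed inside the skew-field of fractions of $R$. *)

theory Defs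
  imports Main
begin

text \<open>Throughout, the ambient type 'a (a division ring) plays the role of the skew-field of
fractions of R; the base field K, the algebra R and all subalgebras R_k are subsets of it.\<close>

definition is_subfield :: "'a::division_ring set \<Rightarrow> bool" where
  "is_subfield K \<longleftrightarrow> 0 \<in> K \<and> 1 \<in> K \<and>
     (\<forall>a\<in>K. \<forall>b\<in>K. a + b \<in> K \<and> a * b \<in> K \<and> - a \<in> K) \<and>
     (\<forall>a\<in>K. a \<noteq> 0 \<longrightarrow> inverse a \<in> K)"

inductive_set gen_ring :: "'a::ring_1 set \<Rightarrow> 'a set" for S where
  base: "a \<in> S \<Longrightarrow> a \<in> gen_ring S"
| zero: "0 \<in> gen_ring S"
| one: "1 \<in> gen_ring S"
| neg: "a \<in> gen_ring S \<Longrightarrow> - a \<in> gen_ring S"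
| add: "a \<in> gen_ring S \<Longrightarrow> b \<in> gen_ring S \<Longrightarrow> a + b \<in> gen_ring S"
| mult: "a \<in> gen_ring S \<Longrightarrow> b \<in> gen_ring S \<Longrightarrow> a * b \<in> gen_ring S"

text \<open>R_k = K[x_1][x_2;..]...[x_k;..], the K-subalgebra generated by x_1,...,x_k; R_0 = K.\<close>
definition Rk :: "'a::division_ring set \<Rightarrow> (nat \<Rightarrow> 'a) \<Rightarrow> nat \<Rightarrow> 'a set" where
  "Rk K x k = gen_ring (K \<union> x ` {1..k})"

definition ore_ext :: "'a::division_ring set \<Rightarrow> 'a set \<Rightarrow> 'a \<Rightarrow> ('a \<Rightarrow> 'a) \<Rightarrow> ('a \<Rightarrow> 'a) \<Rightarrow> bool" where
  "ore_ext K A t \<sigma> \<delta> \<longleftrightarrow>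
     bij_betw \<sigma> A A \<and>
     (\<forall>a\<in>A. \<forall>b\<in>A. \<sigma> (a + b) = \<sigma> a + \<sigma> b \<and> \<sigma> (a * b) = \<sigma> a * \<sigma> b) \<and>
     (\<forall>c\<in>K. \<sigma> c = c) \<and>
     \<delta> ` A \<subseteq> A \<and>
     (\<forall>a\<in>A. \<forall>b\<in>A. \<delta> (a + b) = \<delta> a + \<delta> b \<and> \<delta> (a * b) = \<sigma> a * \<delta> b + \<delta> a * b) \<and>
     (\<forall>c\<in>K. \<forall>a\<in>A. \<delta> (c * a) = c * \<delta> a) \<and>
     (\<forall>a\<in>A. t * a = \<sigma> a * t + \<delta> a) \<and>
     (\<forall>(c::nat \<Rightarrow> 'a) m. (\<forall>i\<le>m. c i \<in> A) \<longrightarrow> (\<Sum>i\<le>m. c i * t ^ i) = 0 \<longrightarrow> (\<forall>i\<le>m. c i = 0))"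

definition torus :: "'a::division_ring set \<Rightarrow> nat \<Rightarrow> (nat \<Rightarrow> 'a) set" where
  "torus K n = {h. (\<forall>i<n. h i \<in> K \<and> h i \<noteq> 0) \<and> (\<forall>i\<ge>n. h i = 1)}"

definition homogeneous :: "'a::division_ring set \<Rightarrow> nat \<Rightarrow> ((nat \<Rightarrow> 'a) \<Rightarrow> 'a \<Rightarrow> 'a) \<Rightarrow> 'a \<Rightarrow> bool" where
  "homogeneous K n act u \<longleftrightarrow> u \<noteq> 0 \<and> (\<forall>h\<in>torus K n. \<exists>c\<in>K. act h u = c * u)"

definition normal_elt :: "'a::ring_1 set \<Rightarrow> 'a \<Rightarrow> bool" where
  "normal_elt A u \<longleftrightarrow> u \<in> A \<and> {u * r |r. r \<in> A} = {r * u |r. r \<in> A}"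

definition completely_prime :: "'a::ring_1 set \<Rightarrow> 'a set \<Rightarrow> bool" where
  "completely_prime A P \<longleftrightarrow> P \<subseteq> A \<and> P \<noteq> A \<and>
     (\<forall>a\<in>A. \<forall>b\<in>A. a * b \<in> P \<longrightarrow> a \<in> P \<or> b \<in> P)"

definition prime_elt :: "'a::ring_1 set \<Rightarrow> 'a \<Rightarrow> bool" where
  "prime_elt A u \<longleftrightarrow> u \<noteq> 0 \<and> normal_elt A u \<and> completely_prime A {u * r |r. r \<in> A}"

definition QNA ::
  "'a::division_ring set \<Rightarrow> nat \<Rightarrow> (nat \<Rightarrow> 'a) \<Rightarrow> (nat \<Rightarrow> 'a \<Rightarrow> 'a) \<Rightarrow> (nat \<Rightarrow> 'a \<Rightarrow> 'a)
    \<Rightarrow> (nat \<Rightarrow> nat \<Rightarrow> 'a) \<Rightarrow> nat \<Rightarrow> ((nat \<Rightarrow> 'a) \<Rightarrow> 'a \<Rightarrow> 'a) \<Rightarrow> bool" where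
  "QNA K N x \<sigma> \<delta> lam n act \<longleftrightarrow>
     is_subfield K \<and> (\<forall>m::nat. m > 0 \<longrightarrow> (of_nat m :: 'a) \<noteq> 0) \<and>
     (\<forall>c\<in>K. \<forall>r\<in>Rk K x N. c * r = r * c) \<and>
     (\<forall>k\<in>{1..N}. ore_ext K (Rk K x (k - 1)) (x k) (\<sigma> k) (\<delta> k)) \<and>
     \<comment> \<open>(i)\<close>
     (\<forall>k\<in>{1..N}. \<forall>j\<in>{1..<k}. lam k j \<in> K \<and> lam k j \<noteq> 0 \<and> \<sigma> k (x j) = lam k j * x j) \<and>
     \<comment> \<open>(ii)\<close>
     (\<forall>k\<in>{1..N}. \<forall>a\<in>Rk K x (k - 1). \<exists>m. (\<delta> k ^^ m) a = 0) \<and>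
     \<comment> \<open>rank\<close>
     n = card {k\<in>{1..N}. \<forall>a\<in>Rk K x (k - 1). \<delta> k a = 0} \<and>
     \<comment> \<open>action of H = (K^*)^n on R by K-algebra automorphisms\<close>
     (\<forall>h\<in>torus K n. bij_betw (act h) (Rk K x N) (Rk K x N) \<and>
        (\<forall>a\<in>Rk K x N. \<forall>b\<in>Rk K x N. act h (a + b) = act h a + act h b \<and> act h (a * b) = act h a * act h b) \<and>
        (\<forall>c\<in>K. act h c = c)) \<and>
     (\<forall>a\<in>Rk K x N. act (\<lambda>i. 1) a = a) \<and>
     (\<forall>h\<in>torus K n. \<forall>h'\<in>torus K n. \<forall>a\<in>Rk K x N. act (\<lambda>i. h i * h' i) a = act h (act h' a)) \<and>
     \<comment> \<open>rationality: each x_i is an eigenvector with a rational character\<close>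
     (\<exists>e::nat \<Rightarrow> nat \<Rightarrow> int. \<forall>i\<in>{1..N}. \<forall>h\<in>torus K n.
         act h (x i) = prod_list (map (\<lambda>j. h j powi e i j) [0..<n]) * x i) \<and>
     \<comment> \<open>(iii)\<close>
     (\<forall>k\<in>{1..N}. \<exists>h\<in>torus K n. (\<forall>a\<in>Rk K x (k - 1). act h a = \<sigma> k a) \<and>
         (\<exists>q\<in>K. q \<noteq> 0 \<and> (\<forall>m::nat. m > 0 \<longrightarrow> q ^ m \<noteq> 1) \<and> act h (x k) = q * x k))"

text \<open>Predecessor set {j < k : mu j = mu k}; p(k) is its maximum when nonempty.\<close>
definition pred_set :: "(nat \<Rightarrow> nat) \<Rightarrow> nat \<Rightarrow> nat set" where
  "pred_set \<mu> k = {j\<in>{1..<k}. \<mu> j = \<mu> k}"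

text \<open>Goodearl--Yakimov elements y_1..y_N with respect to mu.  The condition s(j) > k
  means no j' with j < j' \<le> k has mu j' = mu j.\<close>
definition GY_elements ::
  "'a::division_ring set \<Rightarrow> nat \<Rightarrow> (nat \<Rightarrow> 'a) \<Rightarrow> nat \<Rightarrow> ((nat \<Rightarrow> 'a) \<Rightarrow> 'a \<Rightarrow> 'a)
     \<Rightarrow> (nat \<Rightarrow> nat) \<Rightarrow> (nat \<Rightarrow> 'a) \<Rightarrow> bool" where
  "GY_elements K N x n act \<mu> y \<longleftrightarrow>
     \<mu> ` {1..N} = {1..n} \<and>
     (\<forall>k\<in>{1..N}. y k \<in> Rk K x N \<and> homogeneous K n act (y k)) \<and>
     (\<forall>k\<in>{1..N}. if pred_set \<mu> k = {} then y k = x k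
                  else (\<exists>c\<in>Rk K x (k - 1). y k = y (Max (pred_set \<mu> k)) * x k - c)) \<and>
     (\<forall>k\<in>{1..N}. \<forall>u.
        (u \<in> Rk K x k \<and> homogeneous K n act u \<and> prime_elt (Rk K x k) u) \<longleftrightarrow>
        (\<exists>j\<in>{1..k}. (\<forall>j'\<in>{j<..k}. \<mu> j' \<noteq> \<mu> j) \<and> (\<exists>c\<in>K. c \<noteq> 0 \<and> u = c * y j)))"

inductive_set mult_set :: "(nat \<Rightarrow> 'a::ring_1) \<Rightarrow> nat set \<Rightarrow> 'a set" for y I where
  one: "1 \<in> mult_set y I"
| step: "e \<in> mult_set y I \<Longrightarrow> k \<in> I \<Longrightarrow> e * y k \<in> mult_set y I"

text \<open>The localization R E^{-1} viewed inside the division ring (E is an Ore set).\<close>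
definition localization :: "'a::division_ring set \<Rightarrow> 'a set \<Rightarrow> 'a set" where
  "localization R E = {r * inverse e |r e. r \<in> R \<and> e \<in> E}"

end

theory Submission
  imports Defs
begin

text \<open>
  Each \<open>y\<^sub>k\<close> has degree one in \<open>x\<^sub>k\<close> over \<open>R\<^bsub>k-1\<^esub>\<close>, with leading coefficient \<open>1\<close> or \<open>y\<^bsub>p(k)\<^esub>\<close>.
  Comparing leading coefficients in \<open>y\<^sub>k y\<^sub>i = \<phi>(y\<^sub>i) y\<^sub>k\<close> shows by induction on \<open>k\<close> that the
  \<open>y\<^sub>i\<close> quasi-commute. For \<open>k \<noteq> l\<close>, an element \<open>r\<close> of \<open>R\<close> with \<open>r y\<^sub>k \<in> R y\<^sub>l\<close> already lies in \<open>R y\<^sub>l\<close>: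
  in \<open>R\<^sub>m\<close> with \<open>m = max k l\<close> this is the primeness of \<open>y\<^sub>m\<close>, and it passes from \<open>R\<^bsub>m\<^esub>\<close> to \<open>R\<^bsub>m+1\<^esub>\<close> by
  looking at leading coefficients, since \<open>y\<^sub>k\<close> and \<open>y\<^sub>l\<close> are eigenvectors of \<open>\<sigma>\<^bsub>m+1\<^esub>\<close>. Hence every
  letter of a denominator in \<open>E\<^sub>I\<close> with index outside \<open>J\<close> cancels.
\<close>

section \<open>The degree filtration of an Ore extension\<close>

definition subring :: "'a::ring_1 set \<Rightarrow> bool" where
  "subring A \<longleftrightarrow> 0 \<in> A \<and> 1 \<in> A \<and> (\<forall>a\<in>A. \<forall>b\<in>A. a + b \<in> A \<and> a * b \<in> A) \<and> (\<forall>a\<in>A. - a \<in> A)"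

lemma subring_gen_ring: "subring (gen_ring S)"
  unfolding subring_def by (blast intro: gen_ring.intros)

lemma gen_ring_least:
  assumes "subring A" "S \<subseteq> A"
  shows "gen_ring S \<subseteq> A"
proof
  fix a assume "a \<in> gen_ring S"
  then show "a \<in> A"
    by induction (use assms in \<open>auto simp: subring_def\<close>)
qed

lemma gen_ring_mono: "S \<subseteq> T \<Longrightarrow> gen_ring S \<subseteq> gen_ring T"
  by (rule gen_ring_least[OF subring_gen_ring]) (auto intro: gen_ring.base)

text \<open>With coefficients to the left of the powers of \<open>t\<close>, \<open>indep\<close>
  makes leading coefficients well defined, and injectivity of \<open>\<sigma>\<close> keeps them
  nonzero when a power of \<open>t\<close> is moved past them.\<close>

locale ore_extension =
  fixes A :: "'a::division_ring set" and t :: 'a and \<sigma> \<delta> :: "'a \<Rightarrow> 'a"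
  assumes A: "subring A"
    and \<sigma>_in: "a \<in> A \<Longrightarrow> \<sigma> a \<in> A"
    and \<sigma>_inj: "inj_on \<sigma> A"
    and \<sigma>_zero: "\<sigma> 0 = 0"
    and \<delta>_in: "a \<in> A \<Longrightarrow> \<delta> a \<in> A"
    and t_mult: "a \<in> A \<Longrightarrow> t * a = \<sigma> a * t + \<delta> a"
    and indep: "\<forall>i\<le>m. c i \<in> A \<Longrightarrow> (\<Sum>i\<le>m. c i * t ^ i) = 0 \<Longrightarrow> \<forall>i\<le>m. c i = 0"
begin

lemma A_closed [intro, simp]:
  "0 \<in> A" "1 \<in> A" "a \<in> A \<Longrightarrow> b \<in> A \<Longrightarrow> a + b \<in> A"
  "a \<in> A \<Longrightarrow> b \<in> A \<Longrightarrow> a * b \<in> A" "a \<in> A \<Longrightarrow> - a \<in> A"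
  using A by (auto simp: subring_def)

lemma \<sigma>_nonzero: "a \<in> A \<Longrightarrow> a \<noteq> 0 \<Longrightarrow> \<sigma> a \<noteq> 0"
  using \<sigma>_inj \<sigma>_zero A_closed(1) by (metis inj_onD)

lemma \<sigma>_pow_in: "a \<in> A \<Longrightarrow> (\<sigma> ^^ m) a \<in> A"
  by (induction m) (auto intro: \<sigma>_in)

lemma \<sigma>_pow_nonzero: "a \<in> A \<Longrightarrow> a \<noteq> 0 \<Longrightarrow> (\<sigma> ^^ m) a \<noteq> 0"
  by (induction m) (simp_all add: \<sigma>_nonzero \<sigma>_pow_in)

text \<open>The bound is strict, so that \<open>0\<close> has a level of its own and the constants
  form level one. The recursion splits off the top term, which may be zero, for inductions on the
  degree.\<close>

primrec deg_lt :: "nat \<Rightarrow> 'a set" where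
  "deg_lt 0 = {0}"
| "deg_lt (Suc m) = {a * t ^ m + v |a v. a \<in> A \<and> v \<in> deg_lt m}"

lemma deg_lt_SucI: "a \<in> A \<Longrightarrow> v \<in> deg_lt m \<Longrightarrow> a * t ^ m + v \<in> deg_lt (Suc m)"
  by auto

lemma deg_lt_SucE:
  assumes "v \<in> deg_lt (Suc m)"
  obtains a w where "v = a * t ^ m + w" "a \<in> A" "w \<in> deg_lt m"
  using assms by auto

lemma deg_lt_Suc_0: "deg_lt (Suc 0) = A"
  by auto

lemma zero_in_deg_lt: "0 \<in> deg_lt m"
proof (induction m)
  case (Suc m)
  then show ?case using deg_lt_SucI[of 0 0 m] by simp
qed simp

lemma deg_lt_mono_Suc: "v \<in> deg_lt m \<Longrightarrow> v \<in> deg_lt (Suc m)"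
  using deg_lt_SucI[of 0 v m] by simp

lemma deg_lt_mono: "m \<le> n \<Longrightarrow> deg_lt m \<subseteq> deg_lt n"
  by (rule lift_Suc_mono_le[where f = deg_lt]) (auto intro: deg_lt_mono_Suc simp del: deg_lt.simps)

lemma deg_lt_add: "v \<in> deg_lt m \<Longrightarrow> w \<in> deg_lt m \<Longrightarrow> v + w \<in> deg_lt m"
proof (induction m arbitrary: v w)
  case (Suc m)
  obtain a v' b w' where "v = a * t ^ m + v'" "w = b * t ^ m + w'"
    and *: "a \<in> A" "b \<in> A" "v' \<in> deg_lt m" "w' \<in> deg_lt m"
    using Suc.prems by auto
  then have "v + w = (a + b) * t ^ m + (v' + w')"
    by (simp add: algebra_simps)
  with * Suc.IH show ?case by auto
qed simp

lemma deg_lt_lmult: "a \<in> A \<Longrightarrow> v \<in> deg_lt m \<Longrightarrow> a * v \<in> deg_lt m"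
proof (induction m arbitrary: v)
  case (Suc m)
  obtain b w where "v = b * t ^ m + w" and *: "b \<in> A" "w \<in> deg_lt m"
    using Suc.prems by auto
  then have "a * v = (a * b) * t ^ m + a * w"
    by (simp add: algebra_simps)
  with * Suc show ?case by auto
qed simp

declare deg_lt.simps(2) [simp del]

lemma deg_lt_minus: "v \<in> deg_lt m \<Longrightarrow> - v \<in> deg_lt m"
  using deg_lt_lmult[of "- 1" v m] by simp

lemma deg_lt_diff: "v \<in> deg_lt m \<Longrightarrow> w \<in> deg_lt m \<Longrightarrow> v - w \<in> deg_lt m"
  using deg_lt_add[of v m "- w"] deg_lt_minus[of w m] by simp

lemma monom_in_deg_lt: "a \<in> A \<Longrightarrow> a * t ^ m \<in> deg_lt (Suc m)"
  using deg_lt_SucI[of a 0 m] zero_in_deg_lt by simp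

lemma t_mult_deg_lt: "v \<in> deg_lt m \<Longrightarrow> t * v \<in> deg_lt (Suc m)"
proof (induction m arbitrary: v)
  case 0
  then show ?case using zero_in_deg_lt[of "Suc 0"] by simp
next
  case (Suc m)
  obtain a w where v: "v = a * t ^ m + w" and *: "a \<in> A" "w \<in> deg_lt m"
    using Suc.prems by (rule deg_lt_SucE)
  have "t * v = (t * a) * t ^ m + t * w"
    using v by (simp add: algebra_simps)
  also have "\<dots> = \<sigma> a * t ^ Suc m + (\<delta> a * t ^ m + t * w)"
    using * by (simp add: t_mult algebra_simps)
  finally show ?case
    using deg_lt_SucI[OF \<sigma>_in[OF *(1)] deg_lt_add[OF monom_in_deg_lt[OF \<delta>_in[OF *(1)]] Suc.IH[OF *(2)]]]
    by simp
qed

text \<open>Each passage of \<open>t\<close> over a coefficient applies \<open>\<sigma>\<close> to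
  it and leaves a \<open>\<delta>\<close>-term that has lost this factor \<open>t\<close>, hence has
  lower degree.\<close>

lemma power_mult:
  assumes "a \<in> A"
  shows "t ^ m * a - (\<sigma> ^^ m) a * t ^ m \<in> deg_lt m"
proof (induction m)
  case (Suc m)
  define v where "v = t ^ m * a - (\<sigma> ^^ m) a * t ^ m"
  have "t ^ Suc m * a = t * ((\<sigma> ^^ m) a * t ^ m + v)"
    by (simp add: v_def mult.assoc)
  also have "\<dots> = (t * (\<sigma> ^^ m) a) * t ^ m + t * v"
    by (simp add: algebra_simps)
  also have "\<dots> = (\<sigma> ^^ Suc m) a * t ^ Suc m + (\<delta> ((\<sigma> ^^ m) a) * t ^ m + t * v)"
    using assms by (simp add: t_mult \<sigma>_pow_in algebra_simps)
  finally show ?case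
    using Suc assms v_def
    by (auto intro!: deg_lt_add monom_in_deg_lt t_mult_deg_lt \<delta>_in \<sigma>_pow_in)
qed simp

lemma monom_mult:
  assumes "a \<in> A" "b \<in> A"
  shows "a * t ^ m * b - a * (\<sigma> ^^ m) b * t ^ m \<in> deg_lt m"
  using deg_lt_lmult[OF assms(1) power_mult[OF assms(2), of m]]
  by (simp add: right_diff_distrib mult.assoc)

lemma deg_lt_rmult: "v \<in> deg_lt m \<Longrightarrow> b \<in> A \<Longrightarrow> v * b \<in> deg_lt m"
proof (induction m arbitrary: v)
  case (Suc m)
  obtain a w where v: "v = a * t ^ m + w" and *: "a \<in> A" "w \<in> deg_lt m"
    using Suc.prems(1) by (rule deg_lt_SucE)
  have "v * b = a * (\<sigma> ^^ m) b * t ^ m + ((a * t ^ m * b - a * (\<sigma> ^^ m) b * t ^ m) + w * b)"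
    using v by (simp add: algebra_simps)
  also have "\<dots> \<in> deg_lt (Suc m)"
    using * Suc.IH[OF *(2) Suc.prems(2)] Suc.prems(2)
    by (intro deg_lt_SucI deg_lt_add monom_mult A_closed(4) \<sigma>_pow_in)
  finally show ?case .
qed simp

lemma deg_lt_rmult_t: "v \<in> deg_lt m \<Longrightarrow> v * t \<in> deg_lt (Suc m)"
proof (induction m arbitrary: v)
  case 0
  then show ?case using zero_in_deg_lt[of "Suc 0"] by simp
next
  case (Suc m)
  obtain a w where v: "v = a * t ^ m + w" and *: "a \<in> A" "w \<in> deg_lt m"
    using Suc.prems by (rule deg_lt_SucE)
  have "v * t = a * t ^ Suc m + w * t"
    using v by (simp only: distrib_right mult.assoc power_Suc2)
  then show ?case
    using * Suc.IH deg_lt_SucI[of a "w * t" "Suc m"] by presburger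
qed

section \<open>Leading coefficients and degrees of products\<close>

lemma deg_lt_coeffs: "v \<in> deg_lt m \<Longrightarrow> \<exists>c. (\<forall>i. c i \<in> A) \<and> v = (\<Sum>i<m. c i * t ^ i)"
proof (induction m arbitrary: v)
  case 0
  then show ?case by (auto intro!: exI[of _ "\<lambda>_. 0"])
next
  case (Suc m)
  obtain a w where v: "v = a * t ^ m + w" and *: "a \<in> A" "w \<in> deg_lt m"
    using Suc.prems by (rule deg_lt_SucE)
  then obtain c where "\<forall>i. c i \<in> A" "w = (\<Sum>i<m. c i * t ^ i)"
    using Suc.IH by blast
  then show ?case
    using v * by (intro exI[of _ "c(m := a)"]) (auto simp: add.commute)
qed

lemma lead_coeff_zero:
  assumes "a \<in> A" "a * t ^ m \<in> deg_lt m"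
  shows "a = 0"
proof -
  \<comment> \<open>The sign is chosen so that inserting \<open>a\<close> at position
    \<open>m\<close> gives a vanishing sum, to which \<open>indep\<close> applies.\<close>
  obtain c where c: "\<forall>i. c i \<in> A" "- (a * t ^ m) = (\<Sum>i<m. c i * t ^ i)"
    using deg_lt_coeffs[OF deg_lt_minus[OF assms(2)]] by blast
  define d where "d = c(m := a)"
  have "(\<Sum>i\<le>m. d i * t ^ i) = (\<Sum>i<m. c i * t ^ i) + a * t ^ m"
    by (simp add: d_def lessThan_Suc_atMost[symmetric])
  then have "(\<Sum>i\<le>m. d i * t ^ i) = 0"
    using c(2) by (metis add.left_inverse)
  moreover have "\<forall>i\<le>m. d i \<in> A"
    using c assms by (simp add: d_def)
  ultimately have "d m = 0"
    using indep by blast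
  then show ?thesis by (simp add: d_def)
qed

lemma lead_coeff_unique:
  assumes "a \<in> A" "b \<in> A" "v \<in> deg_lt m" "w \<in> deg_lt m" "a * t ^ m + v = b * t ^ m + w"
  shows "a = b"
proof -
  have "(a - b) * t ^ m = w - v"
    using assms(5) by (simp add: algebra_simps)
  then have "(a + - b) * t ^ m \<in> deg_lt m"
    using assms deg_lt_diff by simp
  then have "a + - b = 0"
    by (rule lead_coeff_zero[OF A_closed(3)[OF assms(1) A_closed(5)[OF assms(2)]]])
  then show ?thesis
    by simp
qed

text \<open>The union of the levels is a subring. Closure under products goes by induction on the
  bound of the left factor, because left multiplication by \<open>t\<close> raises a bound by one
  and left multiplication by a coefficient preserves it.\<close>

lemma gen_ring_subset_deg_lt: "gen_ring (A \<union> {t}) \<subseteq> (\<Union>m. deg_lt m)"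
proof (rule gen_ring_least)
  let ?W = "\<Union>m. deg_lt m"
  have add: "v + w \<in> ?W" if vw: "v \<in> ?W" "w \<in> ?W" for v w
  proof -
    obtain m n where "v \<in> deg_lt m" "w \<in> deg_lt n" using vw by blast
    then have "v + w \<in> deg_lt (max m n)"
      using deg_lt_mono[of m "max m n"] deg_lt_mono[of n "max m n"]
      by (intro deg_lt_add) auto
    then show ?thesis by blast
  qed
  have pow: "t ^ m * w \<in> ?W" if "w \<in> ?W" for m w
  proof (induction m)
    case (Suc m)
    then show ?case using t_mult_deg_lt by (auto simp: mult.assoc)
  qed (use that in simp)
  have mult: "v * w \<in> ?W" if "v \<in> deg_lt m" "w \<in> ?W" for v w m
    using that(1)
  proof (induction m arbitrary: v)
    case 0
    then show ?case using zero_in_deg_lt by auto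
  next
    case (Suc m)
    obtain a u where v: "v = a * t ^ m + u" and *: "a \<in> A" "u \<in> deg_lt m"
      using Suc.prems by (rule deg_lt_SucE)
    have "v * w = a * (t ^ m * w) + u * w"
      using v by (simp add: algebra_simps)
    moreover have "a * (t ^ m * w) \<in> ?W"
      using pow[OF that(2), of m] deg_lt_lmult[OF *(1)] by blast
    ultimately show ?case
      using add Suc.IH[OF *(2)] by simp
  qed
  have A_W: "A \<subseteq> ?W"
    using deg_lt_Suc_0 by blast
  show "subring ?W"
    unfolding subring_def
  proof (intro conjI ballI)
    show "0 \<in> ?W" "1 \<in> ?W"
      using A_W A_closed(1,2) by blast+
    show "v + w \<in> ?W" if "v \<in> ?W" "w \<in> ?W" for v w
      using add that .
    show "v * w \<in> ?W" if "v \<in> ?W" "w \<in> ?W" for v w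
      by (rule UN_E[OF that(1)]) (rule mult[OF _ that(2)])
    show "- v \<in> ?W" if "v \<in> ?W" for v
      by (rule UN_E[OF that]) (blast intro: deg_lt_minus)
  qed
  show "A \<union> {t} \<subseteq> ?W"
    using A_W monom_in_deg_lt[of 1 1] by force
qed

text \<open>There are no zero divisors and \<open>\<sigma>\<close> is injective, so right
  multiplication by a linear element with nonzero leading coefficient raises the degree by exactly
  one.\<close>

lemma deg_lt_cancel_linear:
  assumes r: "r \<in> gen_ring (A \<union> {t})" and p: "p \<in> A" "p \<noteq> 0" and c: "c \<in> A"
    and lt: "r * (p * t - c) \<in> deg_lt (Suc d)"
  shows "r \<in> deg_lt d"
proof (rule ccontr)
  assume not: "r \<notin> deg_lt d"
  \<comment> \<open>As \<open>e\<close> is the least strict bound, \<open>f = e - 1\<close> below is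
    the exact degree of \<open>r\<close>, and its coefficient \<open>a\<close> there is
    nonzero.\<close>
  define e where "e = (LEAST e. r \<in> deg_lt e)"
  have "\<exists>e. r \<in> deg_lt e"
    using gen_ring_subset_deg_lt r by blast
  then have re: "r \<in> deg_lt e" and least: "\<And>f. f < e \<Longrightarrow> r \<notin> deg_lt f"
    unfolding e_def by (auto intro: LeastI_ex dest: not_less_Least)
  have "d < e"
    using not re deg_lt_mono[of e d] by (metis not_le subsetD)
  then obtain f where f: "e = Suc f" "d \<le> f"
    by (cases e) auto
  obtain a v where av: "r = a * t ^ f + v" "a \<in> A" "v \<in> deg_lt f"
    using re f(1) deg_lt_SucE by metis
  have "a \<noteq> 0"
    using least[of f] f av by auto
  let ?u = "a * t ^ f * p - a * (\<sigma> ^^ f) p * t ^ f"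
  have u: "?u \<in> deg_lt f"
    using av p monom_mult by simp
  \<comment> \<open>The would-be leading term of degree \<open>f + 1\<close> is isolated; everything
    on the right has degree at most \<open>f\<close>.\<close>
  have "a * (\<sigma> ^^ f) p * t ^ Suc f = r * (p * t - c) - (?u * t + v * p * t - r * c)"
    unfolding av(1) by (simp add: algebra_simps power_commutes)
  moreover have "r * (p * t - c) \<in> deg_lt (Suc f)"
    using lt f deg_lt_mono[of "Suc d" "Suc f"] by blast
  moreover have "?u * t \<in> deg_lt (Suc f)" "v * p * t \<in> deg_lt (Suc f)" "r * c \<in> deg_lt (Suc f)"
    using u av p c re f by (auto intro!: deg_lt_rmult_t deg_lt_rmult)
  ultimately have "a * (\<sigma> ^^ f) p * t ^ Suc f \<in> deg_lt (Suc f)"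
    by (metis deg_lt_add deg_lt_diff)
  then have "a * (\<sigma> ^^ f) p = 0"
    using lead_coeff_zero av p \<sigma>_pow_in by blast
  then show False
    using \<open>a \<noteq> 0\<close> \<sigma>_pow_nonzero[OF p] by simp
qed

text \<open>Passing to the Ore extension is possible because \<open>u\<close> and \<open>w\<close> are \<open>\<sigma>\<close>-eigenvectors: the
  leading coefficient of \<open>r\<close> is then again right divisible by \<open>w\<close>.\<close>

lemma divisibility_lift:
  fixes K :: "'a set"
  assumes K: "is_subfield K" "K \<subseteq> A" "\<forall>c\<in>K. \<sigma> c = c" "\<forall>c\<in>K. \<forall>a\<in>A. c * a = a * c"
    and \<sigma>_mult: "\<And>a b. a \<in> A \<Longrightarrow> b \<in> A \<Longrightarrow> \<sigma> (a * b) = \<sigma> a * \<sigma> b"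
    and u: "u \<in> A" "u \<noteq> 0" "\<sigma> u = cu * u" "cu \<in> K"
    and w: "w \<in> A" "w \<noteq> 0" "\<sigma> w = cw * w" "cw \<in> K"
    and comm: "w * u = c * u * w" "c \<in> K"
    and cancel: "\<And>r s. r \<in> A \<Longrightarrow> s \<in> A \<Longrightarrow> r * u = s * w \<Longrightarrow> \<exists>s'\<in>A. r = s' * w"
    and r: "r \<in> gen_ring (A \<union> {t})" and s: "s \<in> gen_ring (A \<union> {t})" and eq: "r * u = s * w"
  shows "\<exists>s'\<in>gen_ring (A \<union> {t}). r = s' * w"
proof -
  have K_pow: "a ^ m \<in> K" if "a \<in> K" for a m
    using that K(1) by (induction m) (auto simp: is_subfield_def)
  have \<sigma>_pow: "(\<sigma> ^^ m) a = b ^ m * a" if "a \<in> A" "\<sigma> a = b * a" "b \<in> K" for a b m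
  proof (induction m)
    case (Suc m)
    have "b ^ m \<in> A"
      using K_pow that K by blast
    then have "\<sigma> (b ^ m * a) = b ^ m * (b * a)"
      using \<sigma>_mult[of "b ^ m" a] that K(3) K_pow by metis
    then show ?case
      using Suc by (simp add: power_commutes flip: mult.assoc)
  qed simp
  have AR: "A \<subseteq> gen_ring (A \<union> {t})"
    by (auto intro: gen_ring.base)
  have tR: "t ^ m \<in> gen_ring (A \<union> {t})" for m
    by (induction m) (auto intro: gen_ring.intros)
  \<comment> \<open>Induction on the degree bound of \<open>r\<close>: each round removes the
    leading term by subtracting some \<open>h * t ^ d * w\<close>.\<close>
  obtain d where "r \<in> deg_lt d"
    using gen_ring_subset_deg_lt r by blast
  then show ?thesis
    using r s eq
  proof (induction d arbitrary: r s)
    case 0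
    then show ?case using A_closed(1) AR by force
  next
    case (Suc d)
    obtain a v where av: "r = a * t ^ d + v" "a \<in> A" "v \<in> deg_lt d"
      using Suc.prems(1) deg_lt_SucE by metis
    have lc_u: "z * (\<sigma> ^^ d) u = cu ^ d * z * u" if "z \<in> A" for z
      using \<sigma>_pow[OF u(1,3,4)] K_pow[OF u(4)] K(4) that by (metis mult.assoc)
    have lc_w: "z * (\<sigma> ^^ d) w = cw ^ d * z * w" if "z \<in> A" for z
      using \<sigma>_pow[OF w(1,3,4)] K_pow[OF w(4)] K(4) that by (metis mult.assoc)
    have nz: "cu \<noteq> 0" "cw \<noteq> 0"
      using \<sigma>_nonzero u w by auto
    have s_lt: "s \<in> deg_lt (Suc d)"
    proof -
      \<comment> \<open>\<open>deg_lt_cancel_linear\<close> needs a linear right factor, so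
        \<open>s * w = r * u\<close> is multiplied by \<open>t\<close> and \<open>w * t\<close> is
        read as linear with constant term zero.\<close>
      have "s * (w * t - 0) \<in> deg_lt (Suc (Suc d))"
        using Suc.prems deg_lt_rmult_t[OF deg_lt_rmult[OF Suc.prems(1) u(1)]]
        by (simp add: mult.assoc[symmetric])
      then show ?thesis
        using deg_lt_cancel_linear Suc.prems(3) w by blast
    qed
    then obtain b v' where bv: "s = b * t ^ d + v'" "b \<in> A" "v' \<in> deg_lt d"
      using deg_lt_SucE by metis
    \<comment> \<open>These are the lower-degree errors made when the two leading monomials are
      moved past \<open>u\<close> and \<open>w\<close>.\<close>
    let ?m = "a * t ^ d * u - a * (\<sigma> ^^ d) u * t ^ d" and ?n = "b * t ^ d * w - b * (\<sigma> ^^ d) w * t ^ d"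
    have "a * (\<sigma> ^^ d) u * t ^ d + (?m + v * u) = b * (\<sigma> ^^ d) w * t ^ d + (?n + v' * w)"
      using Suc.prems(4) av bv by (simp add: algebra_simps)
    then have "a * (\<sigma> ^^ d) u = b * (\<sigma> ^^ d) w"
      by (rule lead_coeff_unique[rotated -1])
         (use av bv u w \<sigma>_pow_in in \<open>auto intro!: deg_lt_add monom_mult deg_lt_rmult\<close>)
    then have "cu ^ d * a * u = cw ^ d * b * w"
      using lc_u lc_w av bv by simp
    moreover have "cu ^ d * a \<in> A" "cw ^ d * b \<in> A"
      using av bv K K_pow u w by blast+
    ultimately obtain g where g: "g \<in> A" "cu ^ d * a = g * w"
      using cancel by blast
    have icu: "inverse (cu ^ d) \<in> K" and icw: "inverse (cw ^ d) \<in> K"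
      using K(1) K_pow u w nz by (auto simp: is_subfield_def)
    \<comment> \<open>\<open>h\<close> solves \<open>h * (\<sigma> ^^ d) w = a\<close>: one inverse
      undoes the scalar from \<open>w\<close>, the other the scalar in
      \<open>cu ^ d * a = g * w\<close>.\<close>
    define h where "h = inverse (cw ^ d) * inverse (cu ^ d) * g"
    have hA: "h \<in> A"
      using icu icw g K by (auto simp: h_def)
    have "h * (\<sigma> ^^ d) w = cw ^ d * h * w"
      by (rule lc_w[OF hA])
    also have "\<dots> = inverse (cu ^ d) * (g * w)"
      using nz by (simp add: h_def mult.assoc[symmetric])
    also have "\<dots> = a"
      using nz g(2)[symmetric] by (simp add: mult.assoc[symmetric])
    finally have ha: "h * (\<sigma> ^^ d) w = a" .
    define r' where "r' = r - h * t ^ d * w"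
    have "r' = v - (h * t ^ d * w - h * (\<sigma> ^^ d) w * t ^ d)"
      unfolding r'_def av(1) ha by simp
    then have 1: "r' \<in> deg_lt d"
      using av deg_lt_diff monom_mult hA w by presburger
    have htR: "h * t ^ d \<in> gen_ring (A \<union> {t})"
      using hA AR tR gen_ring.mult by blast
    have sub: "p - q \<in> gen_ring (A \<union> {t})" if "p \<in> gen_ring (A \<union> {t})" "q \<in> gen_ring (A \<union> {t})" for p q
      using gen_ring.add[OF that(1) gen_ring.neg[OF that(2)]] by simp
    have 2: "r' \<in> gen_ring (A \<union> {t})"
      unfolding r'_def by (intro sub gen_ring.mult[OF htR]) (use Suc.prems w AR in auto)
    \<comment> \<open>Subtracting \<open>h * t ^ d * w\<close> from \<open>r\<close> subtracts
      \<open>h * t ^ d * w * u\<close> from \<open>r * u\<close>; since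
      \<open>w * u = c * u * w\<close>, this is again a left multiple of \<open>w\<close>, and
      \<open>s'\<close> is the new cofactor.\<close>
    define s' where "s' = s - h * t ^ d * (c * u)"
    have 3: "s' \<in> gen_ring (A \<union> {t})"
      unfolding s'_def
      by (intro sub gen_ring.mult[OF htR] gen_ring.mult[of c]) (use Suc.prems u comm K AR in auto)
    have "r' * u = s * w - h * t ^ d * (w * u)"
      unfolding r'_def using Suc.prems(4) by (simp add: algebra_simps)
    also have "\<dots> = s' * w"
      unfolding s'_def comm(1) by (simp add: algebra_simps)
    finally obtain g' where g': "g' \<in> gen_ring (A \<union> {t})" "r' = g' * w"
      using Suc.IH[OF 1 2 3] by blast
    then have "r = (g' + h * t ^ d) * w"
      unfolding r'_def by (simp add: algebra_simps)
    then show ?case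
      using g'(1) htR gen_ring.add by blast
  qed
qed

end

section \<open>Goodearl--Yakimov elements\<close>

locale gy_algebra =
  fixes K :: "'a::division_ring set" and N n :: nat and x y :: "nat \<Rightarrow> 'a"
    and \<sigma> \<delta> :: "nat \<Rightarrow> 'a \<Rightarrow> 'a" and lam :: "nat \<Rightarrow> nat \<Rightarrow> 'a"
    and act :: "(nat \<Rightarrow> 'a) \<Rightarrow> 'a \<Rightarrow> 'a" and \<mu> :: "nat \<Rightarrow> nat"
  assumes qna: "QNA K N x \<sigma> \<delta> lam n act"
    and gy: "GY_elements K N x n act \<mu> y"
begin

abbreviation R :: "nat \<Rightarrow> 'a set" where
  "R \<equiv> Rk K x"

lemma subfield: "is_subfield K"
  using qna by (simp add: QNA_def)

lemma K_closed:
  "1 \<in> K" "a \<in> K \<Longrightarrow> b \<in> K \<Longrightarrow> a * b \<in> K" "a \<in> K \<Longrightarrow> inverse a \<in> K"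
  using subfield by (auto simp: is_subfield_def)

lemma K_central: "c \<in> K \<Longrightarrow> r \<in> R N \<Longrightarrow> c * r = r * c"
proof -
  have "\<forall>c\<in>K. \<forall>r\<in>R N. c * r = r * c"
    using qna unfolding QNA_def by (elim conjE)
  then show "c \<in> K \<Longrightarrow> r \<in> R N \<Longrightarrow> c * r = r * c"
    by blast
qed

lemma subring_R: "subring (R k)"
  by (simp add: Rk_def subring_gen_ring)

lemma R_mult: "a \<in> R k \<Longrightarrow> b \<in> R k \<Longrightarrow> a * b \<in> R k"
  using subring_R by (auto simp: subring_def)

lemma R_one: "1 \<in> R k"
  using subring_R by (auto simp: subring_def)

lemma K_subset_R: "K \<subseteq> R k"
  by (auto simp: Rk_def intro: gen_ring.base)

lemma R_mono: "j \<le> k \<Longrightarrow> R j \<subseteq> R k"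
  unfolding Rk_def by (rule gen_ring_mono) auto

lemma x_in_R: "k \<ge> 1 \<Longrightarrow> x k \<in> R k"
  by (auto simp: Rk_def intro: gen_ring.base)

text \<open>Identifies \<open>R k\<close> with the ring generated by coefficients and variable that
  the degree lemmas speak about.\<close>

lemma R_step:
  assumes "k \<ge> 1"
  shows "gen_ring (R (k - 1) \<union> {x k}) = R k"
proof
  show "gen_ring (R (k - 1) \<union> {x k}) \<subseteq> R k"
    by (rule gen_ring_least[OF subring_R]) (use assms R_mono[of "k - 1" k] x_in_R in auto)
  have "{1..k} = insert k {1..k - 1}"
    using assms by auto
  then have "K \<union> x ` {1..k} \<subseteq> R (k - 1) \<union> {x k}"
    by (auto simp: Rk_def intro: gen_ring.base)
  then show "R k \<subseteq> gen_ring (R (k - 1) \<union> {x k})"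
    unfolding Rk_def[of K x k] by (rule gen_ring_mono)
qed

lemma ore: "k \<in> {1..N} \<Longrightarrow> ore_ext K (R (k - 1)) (x k) (\<sigma> k) (\<delta> k)"
  using qna by (simp add: QNA_def)

lemma ore_extension:
  assumes "k \<in> {1..N}"
  shows "ore_extension (R (k - 1)) (x k) (\<sigma> k) (\<delta> k)"
proof
  \<comment> \<open>Zero is a scalar, and \<open>\<sigma> k\<close> fixes scalars.\<close>
  have "0 \<in> K" using subfield by (simp add: is_subfield_def)
  then show "\<sigma> k 0 = 0"
    using ore[OF assms] by (simp add: ore_ext_def)
qed (use ore[OF assms] subring_R in \<open>auto simp: ore_ext_def bij_betw_def\<close>)

section \<open>Primeness, normality and linear form of the \<open>y k\<close>\<close>

lemma y_prime:
  assumes "k \<in> {1..N}"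
  shows "y k \<in> R k" "prime_elt (R k) (y k)"
proof -
  have "\<forall>u. (u \<in> R k \<and> homogeneous K n act u \<and> prime_elt (R k) u) \<longleftrightarrow>
        (\<exists>j\<in>{1..k}. (\<forall>j'\<in>{j<..k}. \<mu> j' \<noteq> \<mu> j) \<and> (\<exists>c\<in>K. c \<noteq> 0 \<and> u = c * y j))"
    using gy assms unfolding GY_elements_def by blast
  \<comment> \<open>The interval \<open>{k<..k}\<close> is empty, so \<open>k\<close> itself is an
    admissible index in the description of the homogeneous primes of \<open>R k\<close>, with scalar
    \<open>1\<close>.\<close>
  moreover have "k \<in> {1..k}" "\<forall>j'\<in>{k<..k}. \<mu> j' \<noteq> \<mu> k" "\<exists>c\<in>K. c \<noteq> 0 \<and> y k = c * y k"
    using assms K_closed(1) by (auto intro!: bexI[of _ 1])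
  ultimately show "y k \<in> R k" "prime_elt (R k) (y k)"
    by blast+
qed

lemma y_nonzero: "k \<in> {1..N} \<Longrightarrow> y k \<noteq> 0"
  using y_prime(2) by (auto simp: prime_elt_def)

lemma y_in_R: "k \<in> {1..N} \<Longrightarrow> k \<le> m \<Longrightarrow> y k \<in> R m"
  using y_prime(1) R_mono by blast

lemma y_normal:
  assumes "k \<in> {1..N}" "a \<in> R k"
  shows "\<exists>b\<in>R k. y k * a = b * y k" "\<exists>b\<in>R k. a * y k = y k * b"
proof -
  have "{y k * r |r. r \<in> R k} = {r * y k |r. r \<in> R k}"
    using y_prime(2)[OF assms(1)] by (simp add: prime_elt_def normal_elt_def)
  then show "\<exists>b\<in>R k. y k * a = b * y k" "\<exists>b\<in>R k. a * y k = y k * b"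
    using assms(2) by blast+
qed

text \<open>Complete primeness concerns the ideal \<open>y k * R k\<close>; normality turns it into
  \<open>R k * y k\<close>, the side needed for right denominators.\<close>

lemma y_cancel_prime:
  assumes "k \<in> {1..N}" "a \<in> R k" "b \<in> R k" "s \<in> R k" "a * b = s * y k"
  shows "(\<exists>s'\<in>R k. a = s' * y k) \<or> (\<exists>s'\<in>R k. b = s' * y k)"
proof -
  have "a * b \<in> {y k * r |r. r \<in> R k}"
    using y_normal(2)[OF assms(1,4)] assms(5) by auto
  then have "a \<in> {y k * r |r. r \<in> R k} \<or> b \<in> {y k * r |r. r \<in> R k}"
    using y_prime(2)[OF assms(1)] assms by (simp add: prime_elt_def completely_prime_def)
  then show ?thesis
    using y_normal(1)[OF assms(1)] by blast
qed

text \<open>The last clause records that the leading coefficient is \<open>1\<close> or an earlier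
  \<open>y j\<close>, which is what makes the induction for quasi-commutation possible.\<close>

lemma y_linear:
  assumes "k \<in> {1..N}"
  obtains p c where "p \<in> R (k - 1)" "p \<noteq> 0" "c \<in> R (k - 1)" "y k = p * x k - c"
    "p = 1 \<or> (\<exists>j\<in>{1..<k}. p = y j)"
proof (cases "pred_set \<mu> k = {}")
  case True
  then have "y k = 1 * x k - 0"
    using gy assms by (simp add: GY_elements_def)
  then show thesis
    using that[of 1 0] subring_R[of "k - 1"] by (auto simp: subring_def)
next
  case False
  define j where "j = Max (pred_set \<mu> k)"
  have "finite (pred_set \<mu> k)"
    by (simp add: pred_set_def)
  then have "j \<in> pred_set \<mu> k"
    using False Max_in j_def by blast
  then have j: "j \<in> {1..<k}"
    by (simp add: pred_set_def)
  then have j': "j \<in> {1..N}" "j \<le> k - 1"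
    using assms by auto
  obtain c where "c \<in> R (k - 1)" "y k = y j * x k - c"
    using gy assms False unfolding GY_elements_def j_def by (metis (no_types, lifting))
  then show thesis
    using that[of "y j" c] j y_nonzero[OF j'(1)] y_in_R[OF j'] by blast
qed

section \<open>Eigenvectors of \<open>\<sigma> k\<close> and quasi-commutation\<close>

lemma \<sigma>_y:
  assumes "k \<in> {1..N}" "i \<in> {1..<k}"
  shows "\<exists>c\<in>K. \<sigma> k (y i) = c * y i"
proof -
  have "\<forall>k\<in>{1..N}. \<exists>h\<in>torus K n. (\<forall>a\<in>R (k - 1). act h a = \<sigma> k a) \<and>
         (\<exists>q\<in>K. q \<noteq> 0 \<and> (\<forall>m::nat. m > 0 \<longrightarrow> q ^ m \<noteq> 1) \<and> act h (x k) = q * x k)"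
    using qna unfolding QNA_def by (elim conjE)
  \<comment> \<open>Condition (iii) realises \<open>\<sigma> k\<close> on \<open>R (k - 1)\<close>
    by a torus element, for which the homogeneous \<open>y i\<close> is an eigenvector.\<close>
  then obtain h where h: "h \<in> torus K n" "\<forall>a\<in>R (k - 1). act h a = \<sigma> k a"
    using assms(1) by blast
  have "homogeneous K n act (y i)"
    using gy assms by (simp add: GY_elements_def)
  then obtain c where "c \<in> K" "act h (y i) = c * y i"
    using h(1) by (auto simp: homogeneous_def)
  moreover have "y i \<in> R (k - 1)"
    using assms by (intro y_in_R) auto
  ultimately show ?thesis
    using h(2) by auto
qed

text \<open>Normality gives \<open>y k * y i = b * y k\<close>. The coefficients of
  \<open>x k\<close> then satisfy \<open>p * \<sigma> k (y i) = b * p\<close>, and commuting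
  \<open>p\<close> with \<open>y i\<close> by induction shows that \<open>b\<close> is a scalar
  multiple of \<open>y i\<close>.\<close>

lemma quasi_commute_less:
  assumes "k \<in> {1..N}" "i \<in> {1..<k}"
  shows "\<exists>c\<in>K. y k * y i = c * y i * y k"
  using assms
proof (induction k arbitrary: i rule: less_induct)
  case (less k)
  interpret ore_extension "R (k - 1)" "x k" "\<sigma> k" "\<delta> k"
    using less.prems by (intro ore_extension)
  have i: "i \<in> {1..N}" "i \<le> k - 1" "i \<le> k"
    using less.prems by auto
  obtain p c where pc: "p \<in> R (k - 1)" "p \<noteq> 0" "c \<in> R (k - 1)" "y k = p * x k - c"
    and p: "p = 1 \<or> (\<exists>j\<in>{1..<k}. p = y j)"
    using less.prems(1) by (rule y_linear)
  obtain s where s: "s \<in> K" "\<sigma> k (y i) = s * y i"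
    using \<sigma>_y less.prems by blast
  note yi = y_in_R[OF i(1,2)]
  obtain b where b: "b \<in> R k" "y k * y i = b * y k"
    using y_normal(1)[OF less.prems(1) y_in_R[OF i(1,3)]] by blast
  have yk_yi: "y k * y i = (p * \<sigma> k (y i)) * x k ^ 1 + (p * \<delta> k (y i) - c * y i)"
    unfolding pc(4) using t_mult[OF yi] by (simp add: left_diff_distrib distrib_left mult.assoc)
  have gen: "gen_ring (R (k - 1) \<union> {x k}) = R k"
    using less.prems by (intro R_step) auto
  have low: "p * \<delta> k (y i) - c * y i \<in> deg_lt 1"
    using deg_lt_Suc_0 pc yi \<delta>_in
    by (intro deg_lt_diff) (metis A_closed(4) One_nat_def)+
  \<comment> \<open>Both \<open>y k * y i\<close> and \<open>y k\<close> have degree at most one in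
    \<open>x k\<close>, the latter exactly one, so \<open>b\<close> must be constant in
    \<open>x k\<close>.\<close>
  have "b * (p * x k - c) \<in> deg_lt (Suc 1)"
    using deg_lt_SucI[OF A_closed(4)[OF pc(1) \<sigma>_in[OF yi]] low] b(2) pc(4) yk_yi by argo
  then have "b \<in> deg_lt 1"
    by (rule deg_lt_cancel_linear[OF b(1)[folded gen] pc(1,2,3)])
  then have bA: "b \<in> R (k - 1)"
    using deg_lt_Suc_0 by (metis One_nat_def)
  have "- (b * c) \<in> deg_lt 1"
    using deg_lt_Suc_0 A_closed(4,5) bA pc(3) by (metis One_nat_def)
  moreover have "(p * \<sigma> k (y i)) * x k ^ 1 + (p * \<delta> k (y i) - c * y i) = (b * p) * x k ^ 1 + - (b * c)"
    using b(2) yk_yi unfolding pc(4) by (simp add: right_diff_distrib mult.assoc)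
  ultimately have lead: "p * \<sigma> k (y i) = b * p"
    using lead_coeff_unique[OF A_closed(4)[OF pc(1) \<sigma>_in[OF yi]] A_closed(4)[OF bA pc(1)] low] by blast
  \<comment> \<open>If \<open>p = y j\<close>, the induction hypothesis is taken at the larger of
    \<open>i\<close> and \<open>j\<close>, both below \<open>k\<close>; when \<open>j < i\<close>
    the scalar obtained has to be inverted.\<close>
  have "\<exists>d\<in>K. p * y i = d * y i * p"
  proof (cases "p = 1")
    case True
    then show ?thesis using K_closed(1) by (auto intro!: bexI[of _ 1])
  next
    case False
    then obtain j where j: "j \<in> {1..<k}" "p = y j"
      using p by blast
    consider "i < j" | "i = j" | "j < i" by linarith
    then show ?thesis
    proof cases
      case 1
      then show ?thesis
        using less.IH[of j i] less.prems j by auto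
    next
      case 2
      then show ?thesis using j K_closed(1) by (auto intro!: bexI[of _ 1])
    next
      case 3
      then obtain d where d: "d \<in> K" "y i * y j = d * y j * y i"
        using less.IH[of i j] less.prems j by auto
      have "d \<noteq> 0"
        using d(2) y_nonzero[of i] y_nonzero[of j] i j less.prems by auto
      then have "y j * y i = inverse d * y i * y j"
        using d(2) by (simp add: mult.assoc) (simp flip: mult.assoc)
      then show ?thesis
        using j d K_closed(3) by auto
    qed
  qed
  then obtain d where d: "d \<in> K" "p * y i = d * y i * p"
    by blast
  have "p \<in> R N"
    using R_mono[of "k - 1" N] less.prems by (intro subsetD[OF _ pc(1)]) auto
  then have "b * p = s * (p * y i)"
    using lead s K_central[OF s(1)] by (metis mult.assoc)
  also have "\<dots> = (s * d * y i) * p"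
    using d by (simp add: mult.assoc)
  finally have "b = s * d * y i"
    using pc(2) by simp
  then show ?case
    using b(2) s d K_closed(2) by (auto intro!: bexI[of _ "s * d"])
qed

lemma quasi_commute:
  assumes "k \<in> {1..N}" "i \<in> {1..N}"
  shows "\<exists>c\<in>K. c \<noteq> 0 \<and> y k * y i = c * y i * y k"
proof -
  consider "i < k" | "i = k" | "k < i" by linarith
  then show ?thesis
  proof cases
    case 1
    then obtain c where c: "c \<in> K" "y k * y i = c * y i * y k"
      using quasi_commute_less[of k i] assms by auto
    moreover have "c \<noteq> 0"
      using c(2) y_nonzero assms by force
    ultimately show ?thesis by blast
  next
    case 2
    then show ?thesis using K_closed(1) by (auto intro!: bexI[of _ 1])
  next
    case 3
    then obtain c where c: "c \<in> K" "y i * y k = c * y k * y i"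
      using quasi_commute_less[of i k] assms by auto
    have "c \<noteq> 0"
      using c(2) y_nonzero assms by force
    then have "y k * y i = inverse c * y i * y k"
      using c(2) by (simp add: mult.assoc) (simp flip: mult.assoc)
    then show ?thesis
      using c \<open>c \<noteq> 0\<close> K_closed(3) by (auto intro!: bexI[of _ "inverse c"])
  qed
qed

section \<open>Cancelling \<open>y k\<close> against \<open>y l\<close> for distinct indices\<close>

lemma y_not_multiple:
  assumes "k \<in> {1..N}" "i \<in> {1..<k}" "b \<in> R k"
  shows "y i \<noteq> b * y k"
proof
  assume eq: "y i = b * y k"
  interpret ore_extension "R (k - 1)" "x k" "\<sigma> k" "\<delta> k"
    using assms by (intro ore_extension)
  obtain p c where pc: "p \<in> R (k - 1)" "p \<noteq> 0" "c \<in> R (k - 1)" "y k = p * x k - c"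
    using assms(1) by (rule y_linear)
  \<comment> \<open>\<open>y i\<close> is constant in \<open>x k\<close> while \<open>y k\<close> is
    linear, so the cofactor \<open>b\<close> lands in \<open>deg_lt 0\<close>, that is,
    \<open>b = 0\<close>.\<close>
  have "y i \<in> deg_lt (Suc 0)"
    unfolding deg_lt_Suc_0 using assms by (intro y_in_R) auto
  then have "b * (p * x k - c) \<in> deg_lt (Suc 0)"
    by (simp only: eq pc(4))
  moreover have "b \<in> gen_ring (R (k - 1) \<union> {x k})"
    using assms R_step[of k] by simp
  ultimately have "b \<in> deg_lt 0"
    by (rule deg_lt_cancel_linear[OF _ pc(1,2,3), rotated])
  then have "b = 0"
    unfolding deg_lt.simps(1) by simp
  then show False
    using eq y_nonzero[of i] assms(1,2) by simp
qed

text \<open>The element of larger index is prime here and does not divide the other one. If it is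
  \<open>y l\<close>, it divides \<open>r\<close>. If it is \<open>y k\<close>, it divides
  \<open>s\<close>, and after quasi-commutation \<open>y k\<close> cancels on the right.\<close>

lemma y_cancel_max:
  assumes k: "k \<in> {1..N}" and l: "l \<in> {1..N}" and "k \<noteq> l"
    and r: "r \<in> R (max k l)" and s: "s \<in> R (max k l)" and eq: "r * y k = s * y l"
  shows "\<exists>s'\<in>R (max k l). r = s' * y l"
proof (cases "k < l")
  case True
  then have "\<not> (\<exists>s'\<in>R l. y k = s' * y l)"
    using y_not_multiple[of l k] k l by auto
  then show ?thesis
    using y_cancel_prime[of l r "y k" s] r s l k eq True y_in_R[of k l] by (simp add: max_def)
next
  case False
  then have "l < k"
    using \<open>k \<noteq> l\<close> by simp
  then have "\<not> (\<exists>s'\<in>R k. y l = s' * y k)"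
    using y_not_multiple[of k l] k l by auto
  then obtain g where g: "g \<in> R k" "s = g * y k"
    using y_cancel_prime[of k s "y l" r] r s l k eq \<open>l < k\<close> y_in_R[of l k] by (auto simp: max_def)
  obtain c where c: "c \<in> K" "y k * y l = c * y l * y k"
    using quasi_commute k l by blast
  have "r * y k = g * c * y l * y k"
    using eq g c by (simp add: mult.assoc)
  then have "r = g * c * y l"
    using y_nonzero[OF k] by simp
  then show ?thesis
    using g c K_subset_R R_mult[of g k c] \<open>l < k\<close> by (intro bexI[of _ "g * c"]) (auto simp: max_def)
qed

lemma y_cancel_above:
  assumes k: "k \<in> {1..N}" and l: "l \<in> {1..N}" and "k \<noteq> l" and "max k l \<le> m" "m \<le> N"
    and "r \<in> R m" "s \<in> R m" "r * y k = s * y l"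
  shows "\<exists>s'\<in>R m. r = s' * y l"
  using assms(4-)
proof (induction m arbitrary: r s rule: dec_induct)
  case base
  then show ?case by (intro y_cancel_max[OF k l \<open>k \<noteq> l\<close>])
next
  case (step m)
  have m: "Suc m \<in> {1..N}" "m \<le> N" "k \<le> m" "l \<le> m"
    using step.hyps(1) step.prems(1) by auto
  interpret ore_extension "R m" "x (Suc m)" "\<sigma> (Suc m)" "\<delta> (Suc m)"
    using ore_extension[OF m(1)] by simp
  have gen: "gen_ring (R m \<union> {x (Suc m)}) = R (Suc m)"
    using R_step[of "Suc m"] by simp
  obtain ck cl where eig: "\<sigma> (Suc m) (y k) = ck * y k" "ck \<in> K" "\<sigma> (Suc m) (y l) = cl * y l" "cl \<in> K"
    using \<sigma>_y[OF m(1), of k] \<sigma>_y[OF m(1), of l] k l m by auto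
  \<comment> \<open>The order matters: \<open>divisibility_lift\<close> is used with divisor
    \<open>w = y l\<close> and \<open>u = y k\<close>, and asks for
    \<open>w * u = c * u * w\<close>.\<close>
  obtain c where c: "y l * y k = c * y k * y l" "c \<in> K"
    using quasi_commute k l by blast
  have central: "\<forall>c\<in>K. \<forall>a\<in>R m. c * a = a * c"
    using K_central R_mono[of m N] m by auto
  have hom: "\<forall>c\<in>K. \<sigma> (Suc m) c = c"
    "\<And>a b. a \<in> R m \<Longrightarrow> b \<in> R m \<Longrightarrow> \<sigma> (Suc m) (a * b) = \<sigma> (Suc m) a * \<sigma> (Suc m) b"
    using ore[OF m(1)] by (simp_all add: ore_ext_def)
  show ?case
  proof (rule divisibility_lift[OF subfield K_subset_R hom(1) central _
        y_in_R[OF k m(3)] y_nonzero[OF k] eig(1,2) y_in_R[OF l m(4)] y_nonzero[OF l] eig(3,4) c,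
        unfolded gen])
    show "\<sigma> (Suc m) (a * b) = \<sigma> (Suc m) a * \<sigma> (Suc m) b" if "a \<in> R m" "b \<in> R m" for a b
      using that by (rule hom(2))
    show "\<exists>s'\<in>R m. r = s' * y l" if "r \<in> R m" "s \<in> R m" "r * y k = s * y l" for r s
      using m(2) that by (rule step.IH)
  qed (rule step.prems)+
qed

lemma y_cancel:
  assumes "k \<in> {1..N}" "l \<in> {1..N}" "k \<noteq> l" "r \<in> R N" "s \<in> R N" "r * y k = s * y l"
  shows "\<exists>s'\<in>R N. r = s' * y l"
  by (rule y_cancel_above[OF assms(1-3) _ order_refl assms(4-6)]) (use assms(1,2) in simp)

section \<open>Intersections of localizations\<close>

lemma mult_set_in_R: "e \<in> mult_set y I \<Longrightarrow> I \<subseteq> {1..N} \<Longrightarrow> e \<in> R N"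
proof (induction rule: mult_set.induct)
  case one
  show ?case by (rule R_one)
next
  case (step e k)
  then show ?case using y_in_R[of k N] R_mult by auto
qed

lemma mult_set_nonzero: "e \<in> mult_set y I \<Longrightarrow> I \<subseteq> {1..N} \<Longrightarrow> e \<noteq> 0"
  by (induction rule: mult_set.induct) (use y_nonzero in auto)

lemma mult_set_quasi_commute_y:
  assumes "e \<in> mult_set y I" "I \<subseteq> {1..N}" "k \<in> {1..N}"
  shows "\<exists>c\<in>K. c \<noteq> 0 \<and> y k * e = c * e * y k"
  using assms(1)
proof induction
  case one
  show ?case using K_closed(1) by (auto intro!: bexI[of _ 1])
next
  case (step e j)
  then obtain c where c: "c \<in> K" "c \<noteq> 0" "y k * e = c * e * y k"
    by blast
  obtain d where d: "d \<in> K" "d \<noteq> 0" "y k * y j = d * y j * y k"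
    using quasi_commute[OF assms(3)] step assms(2) by blast
  \<comment> \<open>The new scalar arises to the right of \<open>e\<close>; centrality of
    \<open>K\<close> in \<open>R N\<close> brings it to the front.\<close>
  have e: "e * d = d * e"
    using K_central[OF d(1) mult_set_in_R[OF step(1) assms(2)]] by simp
  have "y k * (e * y j) = c * e * (y k * y j)"
    using c(3) by (simp flip: mult.assoc)
  also have "\<dots> = c * (e * d) * y j * y k"
    using d(3) by (simp add: mult.assoc)
  also have "\<dots> = (c * d) * (e * y j) * y k"
    by (simp add: e mult.assoc)
  finally show ?case
    using c d K_closed(2) by (intro bexI[of _ "c * d"]) auto
qed

lemma mult_set_quasi_commute:
  assumes "f \<in> mult_set y J" "e \<in> mult_set y I" "I \<subseteq> {1..N}" "J \<subseteq> {1..N}"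
  shows "\<exists>c\<in>K. c \<noteq> 0 \<and> f * e = c * e * f"
  using assms(1)
proof induction
  case one
  show ?case using K_closed(1) by (auto intro!: bexI[of _ 1])
next
  case (step f k)
  then obtain c where c: "c \<in> K" "c \<noteq> 0" "f * e = c * e * f"
    by blast
  obtain d where d: "d \<in> K" "d \<noteq> 0" "y k * e = d * e * y k"
    using mult_set_quasi_commute_y[OF assms(2,3)] step assms(4) by blast
  have f: "f * d = d * f"
    using K_central[OF d(1) mult_set_in_R[OF step(1) assms(4)]] by simp
  have "f * y k * e = (f * d) * e * y k"
    using d(3) by (simp add: mult.assoc)
  also have "\<dots> = d * (f * e) * y k"
    by (simp add: f mult.assoc)
  also have "\<dots> = (d * c) * e * (f * y k)"
    using c(3) by (simp add: mult.assoc)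
  finally show ?case
    using c d K_closed(2) by (intro bexI[of _ "d * c"]) auto
qed

text \<open>The letters of \<open>f\<close> are stripped from the right by \<open>y_cancel\<close>,
  which applies because \<open>k \<notin> J\<close> makes every index met different from
  \<open>k\<close>.\<close>

lemma mult_set_cancel:
  assumes "f \<in> mult_set y J" "J \<subseteq> {1..N}" "k \<in> {1..N}" "k \<notin> J"
    and "r \<in> R N" "s \<in> R N" "r * f = s * y k"
  shows "\<exists>s'\<in>R N. r = s' * y k"
  using assms(1,6,7)
proof (induction arbitrary: s)
  case one
  then show ?case by auto
next
  case (step f j)
  have "r * f \<in> R N"
    using assms(5) R_mult mult_set_in_R[OF step(1) assms(2)] by blast
  moreover have "r * f * y j = s * y k"
    using step.prems by (simp add: mult.assoc)
  ultimately have "\<exists>s'\<in>R N. r * f = s' * y k"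
    using y_cancel[of j k "r * f" s] step assms(2-4) by blast
  then show ?case using step.IH by blast
qed

text \<open>Membership becomes the existence of a word clearing the denominator, so the later
  induction on words needs no inverses of words.\<close>

lemma localization_iff:
  assumes "I \<subseteq> {1..N}"
  shows "d \<in> localization (R N) (mult_set y I) \<longleftrightarrow> (\<exists>e\<in>mult_set y I. d * e \<in> R N)"
proof
  assume "d \<in> localization (R N) (mult_set y I)"
  then obtain r e where "r \<in> R N" "e \<in> mult_set y I" "d = r * inverse e"
    by (auto simp: localization_def)
  moreover have "e \<noteq> 0"
    using calculation mult_set_nonzero assms by blast
  ultimately show "\<exists>e\<in>mult_set y I. d * e \<in> R N"
    by (auto simp: mult.assoc intro!: bexI[of _ e])
next
  assume "\<exists>e\<in>mult_set y I. d * e \<in> R N"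
  then obtain e where e: "e \<in> mult_set y I" "d * e \<in> R N"
    by blast
  then have "d = (d * e) * inverse e"
    using mult_set_nonzero assms by (simp add: mult.assoc)
  then show "d \<in> localization (R N) (mult_set y I)"
    using e unfolding localization_def by blast
qed

text \<open>Induction on the word \<open>e\<close> with \<open>d\<close> arbitrary: a last letter
  with index in \<open>J\<close> is moved into \<open>d\<close> and later returned to the
  denominator, any other last letter is cancelled.\<close>

lemma exists_common_denominator:
  assumes "e \<in> mult_set y I" and I: "I \<subseteq> {1..N}" and J: "J \<subseteq> {1..N}"
    and "d * e \<in> R N" "f \<in> mult_set y J" "d * f \<in> R N"
  shows "\<exists>g\<in>mult_set y (I \<inter> J). d * g \<in> R N"
  using assms(1,4,6)
proof (induction arbitrary: d)
  case one
  then show ?case by (intro bexI[OF _ mult_set.one])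
next
  case (step e k)
  have k: "k \<in> {1..N}"
    using step(2) I by blast
  have eR: "e \<in> R N"
    using mult_set_in_R step(1) I by blast
  show ?case
  proof (cases "k \<in> J")
    case True
    \<comment> \<open>Up to scalars \<open>y k\<close> commutes with \<open>e\<close> and
      \<open>f\<close>, so both words clear \<open>d * y k\<close>. A word \<open>g\<close> for
      \<open>d * y k\<close> then yields \<open>g * y k\<close> for \<open>d\<close>.\<close>
    obtain c where c: "c \<in> K" "y k * e = c * e * y k"
      using mult_set_quasi_commute_y[OF step(1) I k] by blast
    obtain c' where c': "c' \<in> K" "y k * f = c' * f * y k"
      using mult_set_quasi_commute_y[OF assms(5) J k] by blast
    have ec: "y k * e = e * y k * c"
      using c K_central[OF c(1), of "e * y k"] R_mult[OF eR y_in_R[OF k]] k by (simp add: mult.assoc)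
    have fR: "f * y k \<in> R N"
      using R_mult[OF mult_set_in_R[OF assms(5) J] y_in_R[OF k]] k by simp
    have fc: "y k * f = f * y k * c'"
      using c' K_central[OF c'(1) fR] by (simp add: mult.assoc)
    have "d * y k * e = d * (e * y k) * c"
      using ec by (simp add: mult.assoc)
    then have 1: "d * y k * e \<in> R N"
      using R_mult[OF step.prems(1)] c(1) K_subset_R by auto
    have "d * y k * f = (d * f) * y k * c'"
      using fc by (simp add: mult.assoc)
    then have 2: "d * y k * f \<in> R N"
      using R_mult[OF R_mult[OF step.prems(2) y_in_R[OF k]], of c'] c'(1) K_subset_R k by auto
    obtain g where g: "g \<in> mult_set y (I \<inter> J)" "d * y k * g \<in> R N"
      using step.IH[OF 1 2] by blast
    obtain b where b: "b \<in> K" "b \<noteq> 0" "y k * g = b * g * y k"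
      using mult_set_quasi_commute_y[OF g(1) _ k] I by blast
    have "g * y k \<in> R N"
      using R_mult[OF mult_set_in_R[OF g(1)] y_in_R[OF k]] k I by auto
    then have "y k * g = g * y k * b"
      using b K_central[OF b(1)] by (simp add: mult.assoc)
    then have "d * (g * y k) = d * y k * g * inverse b"
      using b(2) by (simp add: mult.assoc)
    then have "d * (g * y k) \<in> R N"
      using R_mult[OF g(2)] K_closed(3)[OF b(1)] K_subset_R by auto
    then show ?thesis
      using mult_set.step[OF g(1)] True step(2) by blast
  next
    case False
    have ek: "e * y k \<in> mult_set y I"
      using mult_set.step step by blast
    obtain c where c: "c \<in> K" "e * y k * f = c * f * (e * y k)"
      using mult_set_quasi_commute[OF ek assms(5) J I] by blast
    have "f \<in> R N"
      using mult_set_in_R assms(5) J by blast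
    then have cf: "c * f = f * c"
      using K_central c by blast
    \<comment> \<open>Moving \<open>f\<close> to the left past \<open>e * y k\<close> uses
      \<open>d * f \<in> R N\<close> to exhibit a left multiple of \<open>y k\<close>. Cancelling
      \<open>f\<close> and then \<open>y k\<close> leaves \<open>d * e \<in> R N\<close>, with a
      shorter word.\<close>
    have "d * (e * y k) * f = (d * f * c * e) * y k"
      using c(2) cf by (metis mult.assoc)
    moreover have "d * f * c * e \<in> R N"
      using step.prems(2) c(1) eR K_subset_R R_mult by blast
    ultimately obtain s where s: "s \<in> R N" "d * (e * y k) = s * y k"
      using mult_set_cancel[OF assms(5) J k False step.prems(1)] by blast
    then have "d * e = s"
      using y_nonzero[OF k] by (simp flip: mult.assoc)
    then show ?thesis
      using step.IH[of d] s(1) step.prems(2) by blast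
  qed
qed

end

lemma mult_set_mono: "I \<subseteq> J \<Longrightarrow> mult_set y I \<subseteq> mult_set y J"
proof
  fix e assume "I \<subseteq> J" and "e \<in> mult_set y I"
  from this(2,1) show "e \<in> mult_set y J"
    by induction (auto intro: mult_set.intros)
qed

theorem theorem3p6:
  fixes K :: "'a::division_ring set" and N n :: nat and x y :: "nat \<Rightarrow> 'a"
    and \<sigma> \<delta> :: "nat \<Rightarrow> 'a \<Rightarrow> 'a" and lam :: "nat \<Rightarrow> nat \<Rightarrow> 'a"
    and act :: "(nat \<Rightarrow> 'a) \<Rightarrow> 'a \<Rightarrow> 'a" and \<mu> :: "nat \<Rightarrow> nat"
    and I J :: "nat set"
  assumes qna: "QNA K N x \<sigma> \<delta> lam n act"
    and frac: "\<forall>d::'a. \<exists>a\<in>Rk K x N. \<exists>b\<in>Rk K x N. b \<noteq> 0 \<and> d = a * inverse b"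
    and gy: "GY_elements K N x n act \<mu> y"
    and I: "I \<subseteq> {1..N}" and J: "J \<subseteq> {1..N}"
  shows "localization (Rk K x N) (mult_set y I) \<inter> localization (Rk K x N) (mult_set y J)
           = localization (Rk K x N) (mult_set y (I \<inter> J))"
proof
  interpret gy_algebra K N n x y \<sigma> \<delta> lam act \<mu>
    using qna gy by unfold_locales
  have IJ: "I \<inter> J \<subseteq> {1..N}"
    using I by blast
  show "localization (R N) (mult_set y I) \<inter> localization (R N) (mult_set y J)
      \<subseteq> localization (R N) (mult_set y (I \<inter> J))"
  proof
    fix d assume "d \<in> localization (R N) (mult_set y I) \<inter> localization (R N) (mult_set y J)"
    then obtain e f where "e \<in> mult_set y I" "d * e \<in> R N" "f \<in> mult_set y J" "d * f \<in> R N"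
      using localization_iff[OF I, of d] localization_iff[OF J, of d] by blast
    then show "d \<in> localization (R N) (mult_set y (I \<inter> J))"
      using exists_common_denominator[OF _ I J] localization_iff[OF IJ, of d] by blast
  qed
  show "localization (R N) (mult_set y (I \<inter> J))
      \<subseteq> localization (R N) (mult_set y I) \<inter> localization (R N) (mult_set y J)"
    using mult_set_mono[of "I \<inter> J" I y] mult_set_mono[of "I \<inter> J" J y]
    by (auto simp: localization_def)
qed

end
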